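(* Let $r, m \in \mathbb{N}_{>0}$ and $k \in \mathbb{N}$. Then $$\frac{m^k}{(r+1)^k} \le \mathcal{M}_r(k,m) \le \frac{m^k}{(r+1)^k} + m^{k-1}\,\frac{(r+1)^k - 1 - kr}{(r+1)^k\, r\,(r+2)}.$$
   Context: $\mathbb{N}$ denotes the nonnegative integers and $\mathbb{N}_{>0}$ the positive integers. For $r \in \mathbb{N}_{>0}$, the beta distribution with parameters $(1,r)$ is the probability distribution on $\mathbb{R}$ with density $g_r(x) = r(1-x)^{r-1}$ if $x \in [0,1]$ and $g_r(x) = 0$ otherwise (with $0^0=1$). For $k \in \mathbb{N}$ and $m \in \mathbb{N}_{>0}$, define $$\mathcal{M}_r(k,m) = \mathbb{E}\left[(X_1+\dots+X_m)^k\right],$$ where $X_1,\dots,X_m$ are independent random variables each having the beta$(1,r)$ distribution. *)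

theory Defs
  imports "HOL-Probability.Probability"
begin

definition beta_density :: "nat \<Rightarrow> real \<Rightarrow> real" where
  "beta_density r x = (if x \<in> {0..1} then real r * (1 - x) ^ (r - 1) else 0)"

definition beta_distribution :: "nat \<Rightarrow> real measure" where
  "beta_distribution r = density lborel (\<lambda>x. ennreal (beta_density r x))"

text \<open>
  The independent random variables are realised as the coordinate projections of the product
  space. By the lemma \<open>beta_moment_eq_expectation\<close> below, every family of independent
  random variables with this distribution, on any probability space, gives the same value for
  \<open>m > 0\<close>.
\<close>

definition beta_moment :: "nat \<Rightarrow> nat \<Rightarrow> nat \<Rightarrow> real" where
  "beta_moment r k m =
     (\<integral>x. (\<Sum>i=1..m. x i) ^ k \<partial>(\<Pi>\<^sub>M i\<in>{1..m}. beta_distribution r))"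

lemma borel_measurable_beta_density [measurable]: "beta_density r \<in> borel_measurable borel"
  unfolding beta_density_def by measurable

lemma sets_beta_distribution [measurable_cong]: "sets (beta_distribution r) = sets borel"
  by (simp add: beta_distribution_def)

lemma prob_space_beta_distribution:
  assumes "r > 0"
  shows "prob_space (beta_distribution r)"
proof
  have "emeasure (beta_distribution r) (space (beta_distribution r)) =
      (\<integral>\<^sup>+ x. ennreal (real r * (1 - x) ^ (r - 1)) * indicator {0..1} x \<partial>lborel)"
    by (auto simp: beta_distribution_def emeasure_density beta_density_def
        intro!: nn_integral_cong split: split_indicator)
  also have "\<dots> = ennreal (- ((1 - 1) ^ r) - (- ((1 - 0) ^ r)))"
    by (rule nn_integral_FTC_Icc[where F = "\<lambda>x. - ((1 - x) ^ r)"])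
       (auto intro!: derivative_eq_intros)
  also have "\<dots> = 1"
    using assms by simp
  finally show "emeasure (beta_distribution r) (space (beta_distribution r)) = 1" .
qed

lemma beta_moment_eq_expectation:
  fixes X :: "nat \<Rightarrow> 'a \<Rightarrow> real"
  assumes "prob_space M" and "m > 0"
    and indep: "prob_space.indep_vars M (\<lambda>_. borel) X {1..m}"
    and distr: "\<And>i. i \<in> {1..m} \<Longrightarrow> distributed M lborel (X i) (\<lambda>x. ennreal (beta_density r x))"
  shows "beta_moment r k m = prob_space.expectation M (\<lambda>\<omega>. (\<Sum>i=1..m. X i \<omega>) ^ k)"
proof -
  interpret prob_space M by fact
  have X [measurable]: "random_variable borel (X i)" if "i \<in> {1..m}" for i
    using indep that by (auto simp: indep_vars_def)
  have D: "distr M borel (X i) = beta_distribution r" if "i \<in> {1..m}" for i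
  proof -
    have "distr M borel (X i) = distr M lborel (X i)"
      by (rule distr_cong) auto
    then show ?thesis
      using distr[OF that] by (simp add: distributed_def beta_distribution_def)
  qed
  have "distr M (\<Pi>\<^sub>M i\<in>{1..m}. borel) (\<lambda>\<omega>. \<lambda>i\<in>{1..m}. X i \<omega>) =
      (\<Pi>\<^sub>M i\<in>{1..m}. distr M borel (X i))"
    using indep X assms(2) by (subst (asm) indep_vars_iff_distr_eq_PiM') auto
  also have "\<dots> = (\<Pi>\<^sub>M i\<in>{1..m}. beta_distribution r)"
    by (rule PiM_cong) (auto simp: D)
  finally have "beta_moment r k m =
      (\<integral>x. (\<Sum>i=1..m. x i) ^ k
        \<partial>distr M (\<Pi>\<^sub>M i\<in>{1..m}. borel) (\<lambda>\<omega>. \<lambda>i\<in>{1..m}. X i \<omega>))"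
    by (simp add: beta_moment_def)
  also have "\<dots> = expectation (\<lambda>\<omega>. (\<Sum>i=1..m. (\<lambda>i\<in>{1..m}. X i \<omega>) i) ^ k)"
    by (rule integral_distr) measurable
  also have "\<dots> = expectation (\<lambda>\<omega>. (\<Sum>i=1..m. X i \<omega>) ^ k)"
    by (intro Bochner_Integration.integral_cong refl arg_cong[where f = "\<lambda>x. x ^ k"] sum.cong) auto
  finally show ?thesis .
qed

end

theory Submission
  imports Defs
begin

text \<open>
  Let \<open>\<mu> = 1 / (r + 1)\<close> be the common mean and \<open>Y = (X\<^sub>1 + \<dots> + X\<^sub>m) / m\<close>. The remainder of the
  tangent of \<open>y ^ k\<close> at \<open>\<mu>\<close> is \<open>(y - \<mu>)\<^sup>2 Q y\<close>, where \<open>Q\<close> is a polynomial with nonnegative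
  coefficients. Hence \<open>0 \<le> Q y \<le> Q 1\<close> on the unit interval, and integrating gives
  \<open>\<mu> ^ k \<le> \<E> (Y ^ k) \<le> \<mu> ^ k + Q 1 * Var X\<^sub>1 / m\<close>. The value of \<open>Q 1\<close> is read off from
  the tangent identity at \<open>y = 1\<close>.
\<close>

section \<open>Polynomial remainder of the tangent to \<open>y ^ k\<close>\<close>

text \<open>This is the quotient of \<open>y ^ k\<close> minus its tangent at \<open>a\<close> by
  the square of \<open>y - a\<close>, written without division. The exponent \<open>i - 1\<close>
  truncates only at \<open>i = 0\<close>, where the factor \<open>of_nat i\<close> removes the
  term.\<close>

definition tangent_quotient :: "'a::comm_ring_1 \<Rightarrow> nat \<Rightarrow> 'a \<Rightarrow> 'a" where
  "tangent_quotient a k y = (\<Sum>i<k. of_nat i * a ^ (i - 1) * y ^ (k - 1 - i))"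

text \<open>Horner step: the new top index \<open>i = k\<close> has exponent 0 in \<open>y\<close>,
  and every earlier term gains one factor \<open>y\<close>.\<close>

lemma tangent_quotient_Suc:
  "tangent_quotient a (Suc k) y = y * tangent_quotient a k y + of_nat k * a ^ (k - 1)"
proof -
  have "y ^ (k - i) = y * y ^ (k - 1 - i)" if "i < k" for i
    using that by (metis Suc_diff_Suc diff_Suc_eq_diff_pred power_Suc)
  then have "(\<Sum>i<k. of_nat i * a ^ (i - 1) * y ^ (k - i)) = y * tangent_quotient a k y"
    unfolding tangent_quotient_def sum_distrib_left
    by (intro sum.cong refl) (simp add: mult.left_commute)
  then show ?thesis
    by (simp add: tangent_quotient_def)
qed

text \<open>Multiply the identity for \<open>k\<close> by \<open>y\<close>. Since
  \<open>y * (y - a)\<close> is \<open>a * (y - a)\<close> plus the square of \<open>y - a\<close>,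
  the linear term spills \<open>of_nat k * a ^ (k - 1)\<close> into the quadratic coefficient, as
  the recursion of the quotient requires.\<close>

lemma power_eq_tangent_plus_square:
  fixes a y :: "'a::comm_ring_1"
  shows "y ^ k = a ^ k + of_nat k * a ^ (k - 1) * (y - a) + (y - a)\<^sup>2 * tangent_quotient a k y"
proof (induction k)
  case 0
  show ?case by (simp add: tangent_quotient_def)
next
  case (Suc k)
  \<comment> \<open>The case \<open>k = 0\<close> is separate because \<open>k - 1\<close> truncates
    there; both sides are then 0.\<close>
  have *: "of_nat k * a ^ k = of_nat k * a ^ (k - 1) * a"
    by (cases k) (simp_all add: mult_ac)
  have "y ^ Suc k = y * a ^ k + of_nat k * a ^ (k - 1) * (y * (y - a))
      + (y - a)\<^sup>2 * (y * tangent_quotient a k y)"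
    by (subst power_Suc, subst Suc) (simp add: algebra_simps)
  also have "\<dots> = a ^ Suc k + (of_nat k * a ^ k + a ^ k) * (y - a)
      + (y - a)\<^sup>2 * (y * tangent_quotient a k y + of_nat k * a ^ (k - 1))"
    unfolding * by (simp add: algebra_simps power2_eq_square)
  finally show ?case
    by (simp add: tangent_quotient_Suc algebra_simps)
qed

lemma tangent_quotient_nonneg:
  fixes a y :: "'a::linordered_idom"
  assumes "0 \<le> a" "0 \<le> y"
  shows "0 \<le> tangent_quotient a k y"
  using assms by (auto simp: tangent_quotient_def intro!: sum_nonneg)

lemma tangent_quotient_mono:
  fixes a y z :: "'a::linordered_idom"
  assumes "0 \<le> a" "0 \<le> y" "y \<le> z"
  shows "tangent_quotient a k y \<le> tangent_quotient a k z"
  using assms by (auto simp: tangent_quotient_def intro!: sum_mono mult_left_mono power_mono)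

section \<open>Mean and variance of the beta distribution\<close>

lemma has_bochner_integral_beta_distribution_complement:
  assumes "r > 0"
  shows "has_bochner_integral (beta_distribution r) (\<lambda>x. (1 - x) ^ j) (real r / real (r + j))"
proof -
  \<comment> \<open>Powers of \<open>1 - x\<close> merge with the density into a single power, so
    the antiderivative is a monomial in \<open>1 - x\<close>; powers of \<open>x\<close> would need
    an expansion.\<close>
  define F where "F = (\<lambda>x::real. - (real r / real (r + j)) * (1 - x) ^ (r + j))"
  have "has_bochner_integral lborel (\<lambda>x. (real r * (1 - x) ^ (r - 1 + j)) * indicator {0..1} x)
      (F 1 - F 0)"
  proof (rule has_bochner_integral_FTC_Icc_real)
    fix x :: real
    show "(F has_real_derivative real r * (1 - x) ^ (r - 1 + j)) (at x)"
    proof -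
      have r: "r - 1 + j = r + j - 1" "real (r + j) \<noteq> 0"
        using assms by auto
      show ?thesis
        unfolding F_def r(1) using r(2) by (auto intro!: derivative_eq_intros)
    qed
  qed (auto intro!: continuous_intros)
  also have "F 1 - F 0 = real r / real (r + j)"
    using assms by (simp add: F_def)
  also have "(\<lambda>x. (real r * (1 - x) ^ (r - 1 + j)) * indicator {0..1} x) =
      (\<lambda>x. beta_density r x *\<^sub>R (1 - x) ^ j)"
    by (auto simp: beta_density_def power_add split: split_indicator)
  finally show ?thesis
    unfolding beta_distribution_def
    by (intro has_bochner_integral_density) (auto simp: beta_density_def)
qed

lemma has_bochner_integral_beta_distribution_centred:
  assumes "r > 0"
  shows "has_bochner_integral (beta_distribution r) (\<lambda>x. x - 1 / (real r + 1)) 0"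
proof -
  \<comment> \<open>The centred variable is rewritten as the mean \<open>r / (r + 1)\<close> of
    \<open>1 - x\<close> minus \<open>1 - x\<close> itself; the power 0 supplies the
    constant.\<close>
  have "has_bochner_integral (beta_distribution r)
      (\<lambda>x. real r / (real r + 1) * (1 - x) ^ 0 - (1 - x) ^ 1)
      (real r / (real r + 1) * (real r / real (r + 0)) - real r / real (r + 1))"
    by (intro has_bochner_integral_diff has_bochner_integral_mult_right
        has_bochner_integral_beta_distribution_complement assms)
  also have "(\<lambda>x. real r / (real r + 1) * (1 - x) ^ 0 - (1 - x) ^ 1) = (\<lambda>x. x - 1 / (real r + 1))"
    by (auto simp: field_simps)
  finally show ?thesis
    using assms by (simp add: add.commute)
qed

lemma has_bochner_integral_beta_distribution_variance:
  assumes "r > 0"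
  shows "has_bochner_integral (beta_distribution r) (\<lambda>x. (x - 1 / (real r + 1))\<^sup>2)
    (real r / ((real r + 1)\<^sup>2 * (real r + 2)))"
proof -
  \<comment> \<open>\<open>c\<close> is the mean of \<open>1 - x\<close>. The variance is unchanged
    by \<open>x \<mapsto> 1 - x\<close>, so it is the second moment \<open>r / (r + 2)\<close> minus
    the square of \<open>c\<close>.\<close>
  define c where "c = real r / (real r + 1)"
  have "has_bochner_integral (beta_distribution r)
      (\<lambda>x. c\<^sup>2 * (1 - x) ^ 0 - 2 * c * (1 - x) ^ 1 + (1 - x) ^ 2)
      (c\<^sup>2 * (real r / real (r + 0)) - 2 * c * (real r / real (r + 1)) + real r / real (r + 2))"
    by (intro has_bochner_integral_diff has_bochner_integral_add has_bochner_integral_mult_right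
        has_bochner_integral_beta_distribution_complement assms)
  also have "(\<lambda>x. c\<^sup>2 * (1 - x) ^ 0 - 2 * c * (1 - x) ^ 1 + (1 - x) ^ 2) =
      (\<lambda>x. (x - 1 / (real r + 1))\<^sup>2)"
  proof
    fix x :: real
    have mean_eq: "1 / (real r + 1) = 1 - c"
      by (simp add: c_def field_simps)
    show "c\<^sup>2 * (1 - x) ^ 0 - 2 * c * (1 - x) ^ 1 + (1 - x) ^ 2 = (x - 1 / (real r + 1))\<^sup>2"
      unfolding mean_eq by (simp add: power2_eq_square algebra_simps)
  qed
  also have "c\<^sup>2 * (real r / real (r + 0)) - 2 * c * (real r / real (r + 1)) + real r / real (r + 2)
      = real r / (real r + 2) - c\<^sup>2"
    using assms by (simp add: c_def power2_eq_square add.commute)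
  also have "\<dots> = real r / ((real r + 1)\<^sup>2 * (real r + 2))"
    by (simp add: c_def divide_simps) (simp add: power2_eq_square algebra_simps)
  finally show ?thesis .
qed

lemma AE_beta_distribution: "AE x in beta_distribution r. 0 \<le> x \<and> x \<le> 1"
  unfolding beta_distribution_def
  by (subst AE_density) (auto simp: beta_density_def split: if_splits)

section \<open>Moments of coordinates and their sums on product spaces\<close>

lemma has_bochner_integral_PiM_component:
  fixes M :: "'a \<Rightarrow> 'b measure" and f :: "'b \<Rightarrow> 'c::{banach, second_countable_topology}"
  assumes "\<And>i. i \<in> I \<Longrightarrow> prob_space (M i)" "i \<in> I" "has_bochner_integral (M i) f v"
  shows "has_bochner_integral (Pi\<^sub>M I M) (\<lambda>x. f (x i)) v"
proof -
  have "has_bochner_integral (distr (Pi\<^sub>M I M) (M i) (\<lambda>x. x i)) f v"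
    using assms by (simp add: distr_PiM_component)
  moreover have "f \<in> borel_measurable (M i)"
    using assms(3) by (auto simp: has_bochner_integral_iff)
  ultimately show ?thesis
    using \<open>i \<in> I\<close> by (simp add: has_bochner_integral_iff integrable_distr_eq integral_distr)
qed

context product_prob_space
begin

lemma has_bochner_integral_PiM_mult:
  fixes f g :: "'a \<Rightarrow> 'c::{real_normed_field, banach, second_countable_topology}"
  assumes "finite I" "i \<in> I" "j \<in> I" "i \<noteq> j"
    and f: "has_bochner_integral (M i) f u" and g: "has_bochner_integral (M j) g v"
  shows "has_bochner_integral (Pi\<^sub>M I M) (\<lambda>x. f (x i) * g (x j)) (u * v)"
proof -
  \<comment> \<open>Padding with the constant 1 turns a product of two factors into one over all of
    \<open>I\<close>, to which the finite product formula applies; each padding factor integrates to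
    1 in a probability space.\<close>
  define h where "h = (\<lambda>l. if l = i then f else if l = j then g else (\<lambda>_. 1))"
  have h: "integrable (M l) (h l)" for l
    using f g by (auto simp: h_def has_bochner_integral_iff)
  have prod_eq: "(\<Prod>l\<in>I. F l) = F i * F j" if "\<And>l. l \<noteq> i \<Longrightarrow> l \<noteq> j \<Longrightarrow> F l = 1" for F :: "'i \<Rightarrow> 'c"
  proof -
    have "(\<Prod>l\<in>I. F l) = (\<Prod>l\<in>{i, j}. F l)"
      using assms that by (intro prod.mono_neutral_right) auto
    then show ?thesis
      using \<open>i \<noteq> j\<close> by simp
  qed
  have "(\<Prod>l\<in>I. h l (x l)) = f (x i) * g (x j)" for x
    using \<open>i \<noteq> j\<close> by (subst prod_eq) (auto simp: h_def)
  moreover have "(\<Prod>l\<in>I. integral\<^sup>L (M l) (h l)) = u * v"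
    using \<open>i \<noteq> j\<close> f g
    by (subst prod_eq) (auto simp: h_def has_bochner_integral_iff M.prob_space)
  ultimately show ?thesis
    using product_integrable_prod[OF \<open>finite I\<close> h] product_integral_prod[OF \<open>finite I\<close> h]
    by (simp add: has_bochner_integral_iff)
qed

text \<open>Expanding the square leaves only the diagonal: for \<open>i \<noteq> j\<close> the mixed
  term factors by independence into a product of two zero means.\<close>

lemma has_bochner_integral_PiM_sum_square:
  fixes f :: "'i \<Rightarrow> 'a \<Rightarrow> real"
  assumes "finite I"
    and f: "\<And>i. i \<in> I \<Longrightarrow> has_bochner_integral (M i) (f i) 0"
    and v: "\<And>i. i \<in> I \<Longrightarrow> has_bochner_integral (M i) (\<lambda>x. (f i x)\<^sup>2) (v i)"
  shows "has_bochner_integral (Pi\<^sub>M I M) (\<lambda>x. (\<Sum>i\<in>I. f i (x i))\<^sup>2) (\<Sum>i\<in>I. v i)"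
proof -
  have "has_bochner_integral (Pi\<^sub>M I M) (\<lambda>x. f i (x i) * f j (x j)) (if i = j then v i else 0)"
    if "i \<in> I" "j \<in> I" for i j
  proof (cases "i = j")
    case True
    then show ?thesis
      using has_bochner_integral_PiM_component[where M = M, OF prob_space \<open>i \<in> I\<close> v[OF \<open>i \<in> I\<close>]]
      by (simp add: power2_eq_square)
  next
    case False
    then show ?thesis
      using has_bochner_integral_PiM_mult[OF \<open>finite I\<close> that False f f] that by simp
  qed
  then have "has_bochner_integral (Pi\<^sub>M I M) (\<lambda>x. \<Sum>i\<in>I. \<Sum>j\<in>I. f i (x i) * f j (x j))
      (\<Sum>i\<in>I. \<Sum>j\<in>I. if i = j then v i else 0)"
    by (intro has_bochner_integral_sum) auto
  then show ?thesis
    using \<open>finite I\<close> by (simp add: power2_eq_square sum_product)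
qed

end

section \<open>Bounds for the moments of the sum\<close>

theorem proposition3p1:
  fixes r m k :: nat
  assumes "r > 0" and "m > 0"
  shows "real m ^ k / (real r + 1) ^ k \<le> beta_moment r k m \<and>
    beta_moment r k m \<le> real m ^ k / (real r + 1) ^ k +
      real m powi (int k - 1) *
        (((real r + 1) ^ k - 1 - real k * real r) / ((real r + 1) ^ k * real r * (real r + 2)))"
proof -
  interpret product_prob_space "\<lambda>_. beta_distribution r" "{1..m}"
    using prob_space_beta_distribution[OF \<open>r > 0\<close>] by (rule product_prob_spaceI)
  define P where "P = (\<Pi>\<^sub>M i\<in>{1..m}. beta_distribution r)"
  interpret PM: prob_space P
    unfolding P_def by (intro prob_space_PiM prob_space)
  define \<mu> where "\<mu> = 1 / (real r + 1)"
  define \<sigma>2 where "\<sigma>2 = real r / ((real r + 1)\<^sup>2 * (real r + 2))"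
  define S where "S = (\<lambda>x::nat \<Rightarrow> real. \<Sum>i=1..m. x i)"
  define Y where "Y = (\<lambda>x. S x / real m)"
  have \<mu>: "0 \<le> \<mu>" and \<mu>1: "1 - \<mu> = real r / (real r + 1)"
    by (simp_all add: \<mu>_def field_simps)
  have S_meas [measurable]: "S \<in> borel_measurable P"
    unfolding S_def P_def by measurable
  have Y_meas [measurable]: "Y \<in> borel_measurable P"
    unfolding Y_def by measurable
  \<comment> \<open>Centring each coordinate separately reduces mean and variance of
    \<open>Y\<close> to sums of centred independent terms; the variance is
    \<open>m * \<sigma>2\<close> over the square of \<open>m\<close>, that is
    \<open>\<sigma>2 / m\<close>.\<close>
  have Y_centred: "Y x - \<mu> = (\<Sum>i=1..m. x i - \<mu>) / real m" for x
    using \<open>m > 0\<close> by (simp add: Y_def S_def sum_subtractf field_simps)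

  have mean: "has_bochner_integral P (\<lambda>x. Y x - \<mu>) 0"
  proof -
    have "has_bochner_integral P (\<lambda>x. \<Sum>i=1..m. x i - \<mu>) (\<Sum>i=1..m. 0)"
      unfolding P_def \<mu>_def
      using has_bochner_integral_beta_distribution_centred[OF \<open>r > 0\<close>] prob_space
      by (intro has_bochner_integral_sum has_bochner_integral_PiM_component[where f = "\<lambda>x. x - _"])
    then have "has_bochner_integral P (\<lambda>x. (\<Sum>i=1..m. x i - \<mu>) / real m) ((\<Sum>i=1..m. 0) / real m)"
      by (rule has_bochner_integral_divide_zero)
    then show ?thesis
      by (simp add: Y_centred)
  qed
  have var: "has_bochner_integral P (\<lambda>x. (Y x - \<mu>)\<^sup>2) (\<sigma>2 / real m)"
  proof -
    have "has_bochner_integral P (\<lambda>x. (\<Sum>i=1..m. x i - \<mu>)\<^sup>2) (\<Sum>i=1..m. \<sigma>2)"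
      unfolding P_def \<mu>_def \<sigma>2_def
      using has_bochner_integral_beta_distribution_centred[OF \<open>r > 0\<close>]
        has_bochner_integral_beta_distribution_variance[OF \<open>r > 0\<close>]
      by (intro has_bochner_integral_PiM_sum_square[where f = "\<lambda>i x. x - _"]) auto
    then have "has_bochner_integral P (\<lambda>x. (\<Sum>i=1..m. x i - \<mu>)\<^sup>2 / (real m)\<^sup>2)
        ((\<Sum>i=1..m. \<sigma>2) / (real m)\<^sup>2)"
      by (rule has_bochner_integral_divide_zero)
    then show ?thesis
      using \<open>m > 0\<close> by (simp add: Y_centred power_divide power2_eq_square)
  qed

  have Y_bounds: "AE x in P. 0 \<le> Y x \<and> Y x \<le> 1"
  proof -
    have "AE x in P. \<forall>i\<in>{1..m}. 0 \<le> x i \<and> x i \<le> 1"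
      unfolding P_def
      by (intro eventually_ball_finite ballI AE_PiM_component[where P = "\<lambda>x. 0 \<le> x \<and> x \<le> 1"]
          prob_space AE_beta_distribution) auto
    then show ?thesis
    proof eventually_elim
      case (elim x)
      then have "S x \<le> (\<Sum>i=1..m. 1)" "0 \<le> S x"
        unfolding S_def by (intro sum_mono sum_nonneg; simp)+
      then show ?case
        using \<open>m > 0\<close> by (simp add: Y_def)
    qed
  qed
  have integrable_power: "integrable P (\<lambda>x. Y x ^ k)"
    by (intro PM.integrable_const_bound[where B = 1] eventually_mono[OF Y_bounds])
       (auto simp: power_le_one)

  let ?Q = "tangent_quotient \<mu> k"
  let ?t = "\<lambda>x. \<mu> ^ k + real k * \<mu> ^ (k - 1) * (Y x - \<mu>)"
  \<comment> \<open>The linear term has mean zero. The coefficient \<open>c\<close> stays free: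
    \<open>c = 0\<close> gives the lower bound and \<open>c = ?Q 1\<close> the upper one.\<close>
  have tangent: "has_bochner_integral P (\<lambda>x. ?t x + c * (Y x - \<mu>)\<^sup>2) (\<mu> ^ k + c * (\<sigma>2 / real m))"
    for c
  proof -
    have "has_bochner_integral P (\<lambda>x. ?t x + c * (Y x - \<mu>)\<^sup>2)
        (\<mu> ^ k + real k * \<mu> ^ (k - 1) * 0 + c * (\<sigma>2 / real m))"
      using PM.prob_space
      by (intro has_bochner_integral_add has_bochner_integral_mult_right mean var)
         (auto simp: has_bochner_integral_iff)
    then show ?thesis by simp
  qed
  have lower: "\<mu> ^ k \<le> (\<integral>x. Y x ^ k \<partial>P)"
  proof -
    have "AE x in P. ?t x + 0 * (Y x - \<mu>)\<^sup>2 \<le> Y x ^ k"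
      using Y_bounds
    proof eventually_elim
      case (elim x)
      then have "0 \<le> (Y x - \<mu>)\<^sup>2 * ?Q (Y x)"
        using \<mu> by (simp add: tangent_quotient_nonneg)
      then show ?case
        using power_eq_tangent_plus_square[of "Y x" k \<mu>] by simp
    qed
    then show ?thesis
      using integral_mono_AE[OF _ integrable_power] tangent[of 0]
      by (fastforce simp: has_bochner_integral_iff)
  qed
  have upper: "(\<integral>x. Y x ^ k \<partial>P) \<le> \<mu> ^ k + ?Q 1 * (\<sigma>2 / real m)"
  proof -
    have "AE x in P. Y x ^ k \<le> ?t x + ?Q 1 * (Y x - \<mu>)\<^sup>2"
      using Y_bounds
    proof eventually_elim
      case (elim x)
      then have "?Q (Y x) * (Y x - \<mu>)\<^sup>2 \<le> ?Q 1 * (Y x - \<mu>)\<^sup>2"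
        using \<mu> by (intro mult_right_mono tangent_quotient_mono) auto
      then show ?case
        using power_eq_tangent_plus_square[of "Y x" k \<mu>] by (simp add: mult.commute)
    qed
    then show ?thesis
      using integral_mono_AE[OF integrable_power] tangent[of "?Q 1"]
      by (fastforce simp: has_bochner_integral_iff)
  qed

  have moment: "beta_moment r k m = real m ^ k * (\<integral>x. Y x ^ k \<partial>P)"
  proof -
    have "(\<lambda>x. S x ^ k) = (\<lambda>x. real m ^ k * Y x ^ k)"
      using \<open>m > 0\<close> by (simp add: Y_def power_divide)
    then show ?thesis
      by (simp add: beta_moment_def P_def S_def)
  qed
  define C where
    "C = ((real r + 1) ^ k - 1 - real k * real r) / ((real r + 1) ^ k * real r * (real r + 2))"
  \<comment> \<open>At \<open>y = 1\<close> the tangent identity determines \<open>?Q 1\<close>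
    times the square of \<open>1 - \<mu> = r / (r + 1)\<close>. That square is also
    \<open>\<sigma>2 * r * (r + 2)\<close>, so no division by it is needed.\<close>
  have "?Q 1 * \<sigma>2 = C"
  proof -
    define s where "s = real r + 1"
    have "s > 0" and \<mu>_eq: "\<mu> = 1 / s"
      by (simp_all add: s_def \<mu>_def)
    have k_eq: "real k * \<mu> ^ (k - 1) = real k * s / s ^ k"
      using \<open>s > 0\<close> by (cases k) (auto simp: \<mu>_eq field_simps)
    have "1 = 1 / s ^ k + real k * s / s ^ k * (real r / s) + (real r / s)\<^sup>2 * ?Q 1"
      using power_eq_tangent_plus_square[of 1 k \<mu>]
      unfolding k_eq \<mu>1 s_def[symmetric] power_one
      by (simp only: \<mu>_eq power_divide power_one)
    then have Q: "(real r / s)\<^sup>2 * ?Q 1 = (s ^ k - 1 - real k * real r) / s ^ k"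
      using \<open>s > 0\<close> by (simp add: diff_divide_distrib)
    have "\<sigma>2 = (real r / s)\<^sup>2 / (real r * (real r + 2))"
      using \<open>r > 0\<close> by (simp add: \<sigma>2_def s_def[symmetric] power_divide power2_eq_square)
    then have "?Q 1 * \<sigma>2 = (real r / s)\<^sup>2 * ?Q 1 / (real r * (real r + 2))"
      by simp
    then show ?thesis
      unfolding Q C_def s_def[symmetric] by (simp add: mult.assoc)
  qed
  then have upper': "real m ^ k * (\<integral>x. Y x ^ k \<partial>P) \<le> real m ^ k * (\<mu> ^ k + C / real m)"
    using mult_left_mono[OF upper, of "real m ^ k"] by simp
  \<comment> \<open>The integer exponent matters at \<open>k = 0\<close>, where it is -1; there
    \<open>C = 0\<close>, so the correction term vanishes.\<close>
  have "real m powi (int k - 1) = real m ^ k / real m"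
    using \<open>m > 0\<close> by (simp add: power_int_diff)
  then have "real m ^ k * (\<mu> ^ k + C / real m) =
      real m ^ k / (real r + 1) ^ k + real m powi (int k - 1) * C"
    by (simp add: \<mu>_def power_divide distrib_left)
  moreover have "real m ^ k / (real r + 1) ^ k \<le> real m ^ k * (\<integral>x. Y x ^ k \<partial>P)"
    using mult_left_mono[OF lower, of "real m ^ k"] by (simp add: \<mu>_def power_divide)
  ultimately show ?thesis
    using upper' unfolding moment C_def by simp
qed

end
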